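(* Let $a\ge 1$ be a constant, let $n=m^2$ for some positive integer $m$, and let $k$ be an integer with $1\le k\le\sqrt n$. Let $0\le X_1\le\dots\le X_{\sqrt n}$ and $0\le Y_1\le\dots\le Y_{\sqrt n}$ be generated by two independent arbitrary random processes, and let $n$ sensors be placed at the points $(X_{i_1},Y_{i_2})$, $i_1,i_2\in\{1,\dots,\sqrt n\}$. Let $M_1,\dots,M_{\sqrt n}$ and $N_1,\dots,N_{\sqrt n}$ be real displacements with $X_1+M_1\le\dots\le X_{\sqrt n}+M_{\sqrt n}$ and $Y_1+N_1\le\dots\le Y_{\sqrt n}+N_{\sqrt n}$. For $j_1,j_2\in\{0,1,\dots,k-1\}$ let $T^{(a,2)}_{(j_1,j_2,RS)}$ be the $a$-th power of the total distance travelled by the robot of capacity $k$, starting at $(0,0)$, in the algorithm $GM_{j_1,j_2}(k,n)$, which moves each sensor $(X_{i_1},Y_{i_2})$ to $(X_{i_1}+M_{i_1},Y_{i_2}+N_{i_2})$. Let $T^{(a,2)}_{(AS)}=\sum_{i_1,i_2=1}^{\sqrt n}\left(|M_{i_1}|^a+|N_{i_2}|^a\right)$. Then $\min_{0\le j_1,j_2\le k-1}T^{(a,2)}_{(j_1,j_2,RS)}$ is at most $$4^an^{a/2-1/2}\left(4\left\lfloor\frac{\sqrt n}{k}\right\rfloor+16\right)^{a-1}\frac{T^{(a,2)}_{(AS)}}{k}+4^{a-1}n^{a/2}\left(4\left\lfloor\frac{\sqrt n}{k}\right\rfloor+16\right)^{a-1}\left(2|M_1|^a+2|M_{\sqrt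 n}|^a\right)$$ $$+4^{a-1}n^{a/2}\left(4\left\lfloor\frac{\sqrt n}{k}\right\rfloor+16\right)^{a-1}\left(2|N_1|^a+2|N_{\sqrt n}|^a\right)+\left(2^{3a-1}+6^a4^{a-1}n^{a/2}\right)Y_{\sqrt n}^a+\left(4^{a-1}+6^a4^{a-1}n^{a/2}\right)X_{\sqrt n}^a.$$
   Context: The inequality is for every realization of the random positions. The robot can carry at most $k$ sensors at a time; it may pick up and drop sensors anywhere. All walks are along straight segments. One-dimensional greedy procedure $GP(Z_0,Z_1,\dots,Z_l)$, where $1\le l\le k$, $Z_0\le Z_1\le\dots\le Z_l$, and sensor $Z_i$ ($1\le i\le l$) has destination $Z_i+L_i$ with $Z_1+L_1\le\dots\le Z_l+L_l$: the robot starts at $Z_0$, moves right to $Z_l$ collecting the sensors $Z_1,\dots,Z_l$; then it places the sensors at their destinations in the order $l,l-1,\dots,1$ (going straight from $Z_l$ to $Z_l+L_l$, then leftwards from $Z_l+L_l$ to $Z_1+L_1$, dropping sensors on the way); finally it walks straight from $Z_1+L_1$ to $Z_l$, where it ends. One-dimensional algorithm $GM_j(k,N)$ for $N$ sensors $Z_1\le\dots\le Z_N$ in $[0,\infty)$ with destinations $Z_i+L_i$, $j\in\{0,\dots,k-1\}$, $1\le k\le N$, with the convention $Z_0=0$ (the robot's start): 1. If $j>0$, execute $GP(Z_0,Z_1,\dots,Z_j)$. 2. For $i=1,\dots,\lfloor (N-j)/k\rfloor$, execute $GP(Z_{j+k(i-1)},Z_{j+k(i-1)+1},\dots,Z_{j+k(i-1)+k})$.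 3. If $p:=j+k\lfloor (N-j)/k\rfloor<N$, execute $GP(Z_p,Z_{p+1},\dots,Z_N)$. Planar algorithm $GM_{j_1,j_2}(k,n)$, robot starting at $(0,0)$: (1–5) For $i_2=1,\dots,\sqrt n$: the robot walks to $(0,Y_{i_2})$; it executes $GM_{j_2}(k,\sqrt n)$ along the horizontal line of height $Y_{i_2}$ (first coordinate), moving the sensors $(X_{i},Y_{i_2})$ to $(X_{i}+M_{i},Y_{i_2})$, $i=1,\dots,\sqrt n$; it walks back to $(0,Y_{i_2})$. (6) The robot walks to $(0,0)$. (7–11) For $i_1=1,\dots,\sqrt n$: the robot walks to $(X_{i_1}+M_{i_1},0)$; it executes $GM_{j_1}(k,\sqrt n)$ along the vertical line with first coordinate $X_{i_1}+M_{i_1}$ (second coordinate), moving the sensors $(X_{i_1}+M_{i_1},Y_i)$ to $(X_{i_1}+M_{i_1},Y_i+N_i)$, $i=1,\dots,\sqrt n$; it walks back to $(X_{i_1}+M_{i_1},0)$. *)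

theory Defs
  imports "HOL-Analysis.Analysis"
begin

text \<open>
  A run of the robot is recorded as the list of the points it visits, in order; these include every
  point at which a sensor is picked up or dropped. Consecutive points are joined by straight
  segments, and repeated points contribute nothing to the length.
\<close>

fun route_length :: "'a::metric_space list \<Rightarrow> real" where
  "route_length (x # y # ps) = dist x y + route_length (y # ps)"
| "route_length _ = 0"

text \<open>
  The greedy procedure \<open>GP(Z\<^sub>p, Z\<^sub>p\<^sub>+\<^sub>1, \<dots>, Z\<^sub>q)\<close>, \<open>p < q\<close>: start at \<open>Z p\<close>, collect the sensors
  \<open>p+1, \<dots>, q\<close> from left to right, deliver them in the order \<open>q, \<dots>, p+1\<close> to their destinations
  \<open>Z i + L i\<close>, and return to \<open>Z q\<close>.
\<close>

definition GP :: "(nat \<Rightarrow> real) \<Rightarrow> (nat \<Rightarrow> real) \<Rightarrow> nat \<Rightarrow> nat \<Rightarrow> real list" where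
  "GP Z L p q =
     map Z [p..<Suc q] @ map (\<lambda>i. Z i + L i) (rev [Suc p..<Suc q]) @ [Z q]"

text \<open>
  The sensors are \<open>Z 1, \<dots>, Z N\<close>; index \<open>0\<close> is reserved for the start of the robot, which is the
  origin of the line, whatever the value \<open>Z 0\<close> of the given function.
\<close>

definition GM :: "nat \<Rightarrow> nat \<Rightarrow> nat \<Rightarrow> (nat \<Rightarrow> real) \<Rightarrow> (nat \<Rightarrow> real) \<Rightarrow> real list" where
  "GM j k N Z L =
     (let W = Z(0 := 0); p = j + k * ((N - j) div k) in
        (if j > 0 then GP W L 0 j else []) @
        concat (map (\<lambda>i. GP W L (j + k * (i - 1)) (j + k * (i - 1) + k))
                    [1..<Suc ((N - j) div k)]) @
        (if p < N then GP W L p N else []))"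

text \<open>
  The planar algorithm on an \<open>m \<times> m\<close> grid of sensors \<open>(X i\<^sub>1, Y i\<^sub>2)\<close>, that is, \<open>m\<close> is the square
  root of the number of sensors. The parameter \<open>j\<^sub>2\<close> governs the horizontal phase and \<open>j\<^sub>1\<close> the
  vertical one.
\<close>

definition GM_planar ::
  "nat \<Rightarrow> nat \<Rightarrow> nat \<Rightarrow> nat \<Rightarrow> (nat \<Rightarrow> real) \<Rightarrow> (nat \<Rightarrow> real) \<Rightarrow> (nat \<Rightarrow> real) \<Rightarrow> (nat \<Rightarrow> real)
     \<Rightarrow> (real \<times> real) list" where
  "GM_planar j1 j2 k m X Y M N =
     [(0, 0)] @
     concat (map (\<lambda>i2. [(0, Y i2)] @ map (\<lambda>x. (x, Y i2)) (GM j2 k m X M) @ [(0, Y i2)])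
                 [1..<Suc m]) @
     [(0, 0)] @
     concat (map (\<lambda>i1. [(X i1 + M i1, 0)] @ map (\<lambda>y. (X i1 + M i1, y)) (GM j1 k m Y N) @
                       [(X i1 + M i1, 0)])
                 [1..<Suc m])"

definition T_RS ::
  "real \<Rightarrow> nat \<Rightarrow> nat \<Rightarrow> nat \<Rightarrow> nat \<Rightarrow> (nat \<Rightarrow> real) \<Rightarrow> (nat \<Rightarrow> real) \<Rightarrow> (nat \<Rightarrow> real) \<Rightarrow> (nat \<Rightarrow> real)
     \<Rightarrow> real" where
  "T_RS a j1 j2 k m X Y M N = route_length (GM_planar j1 j2 k m X Y M N) powr a"

definition T_AS :: "real \<Rightarrow> nat \<Rightarrow> (nat \<Rightarrow> real) \<Rightarrow> (nat \<Rightarrow> real) \<Rightarrow> real" where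
  "T_AS a m M N = (\<Sum>i1 = 1..m. \<Sum>i2 = 1..m. \<bar>M i1\<bar> powr a + \<bar>N i2\<bar> powr a)"

end

theory Submission
  imports Defs
begin

text \<open>
  A block \<open>p+1, \<dots>, q\<close> of the greedy procedure costs at most \<open>3 (Z\<^sub>q - Z\<^sub>p)\<close> plus twice the
  displacements of its first and its last sensor: the sensors in between cost nothing extra. Over a
  line the first parts telescope, and as \<open>j\<close> varies every sensor is only once the first and once
  the last of a block, the two extreme sensors of the line excepted. So a good shift for each
  direction is found by averaging over \<open>j\<close>, after a weighted power mean inequality. The total
  length is then split into four parts, according to \<open>X\<^sub>m\<close>, \<open>Y\<^sub>m\<close>, \<open>M\<close> and \<open>N\<close>.
\<close>

section \<open>Power means\<close>

text \<open>Displacements may vanish, so the endpoint 0 has to be included. Between 0 and a positive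
  point the claim reduces to \<open>s powr a \<le> s\<close> for \<open>0 < s < 1\<close>, since
  \<open>0 powr a = 0\<close>; two positive points are covered by
  \<open>powr_convex\<close>.\<close>

lemma powr_convex_nonneg:
  fixes a :: real
  assumes "a \<ge> 1"
  shows "convex_on {0..} (\<lambda>x. x powr a)"
proof (rule convex_onI)
  fix t x y :: real
  assume t: "0 < t" "t < 1" and "x \<in> {0..}" "y \<in> {0..}"
  then have nn: "x \<ge> 0" "y \<ge> 0" by auto
  have scale: "(s * z) powr a \<le> s * z powr a" if "0 < s" "s < 1" "z \<ge> 0" for s z :: real
  proof -
    have "s powr a \<le> s powr 1" using that assms by (intro powr_mono') auto
    then show ?thesis using that by (simp add: powr_mult mult_right_mono)
  qed
  consider "x = 0" | "y = 0" | "x > 0" "y > 0" using nn by linarith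
  then show "((1 - t) *\<^sub>R x + t *\<^sub>R y) powr a \<le> (1 - t) * x powr a + t * y powr a"
  proof cases
    case 3
    then show ?thesis
      using convex_onD[OF powr_convex[OF assms], of t x y] t by simp
  qed (use scale[of t y] scale[of "1 - t" x] t nn in auto)
qed simp

text \<open>Jensen's inequality for the weights divided by their sum W; clearing denominators leaves
  W^a / W, the factor in front. If W = 0, every weight vanishes and both sides are 0.\<close>

lemma powr_weighted_sum_le:
  fixes a :: real and w x :: "'i \<Rightarrow> real"
  assumes "a \<ge> 1" "finite I" and w: "\<And>i. i \<in> I \<Longrightarrow> w i \<ge> 0" and x: "\<And>i. i \<in> I \<Longrightarrow> x i \<ge> 0"
  shows "(\<Sum>i\<in>I. w i * x i) powr a \<le> (\<Sum>i\<in>I. w i) powr (a - 1) * (\<Sum>i\<in>I. w i * x i powr a)"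
proof (cases "(\<Sum>i\<in>I. w i) = 0")
  case True
  then have "\<And>i. i \<in> I \<Longrightarrow> w i = 0"
    using assms(2) w by (simp add: sum_nonneg_eq_0_iff)
  then show ?thesis by simp
next
  case False
  define W where "W = (\<Sum>i\<in>I. w i)"
  have W: "W > 0" using False w sum_nonneg[of I w] unfolding W_def by fastforce
  have "(\<Sum>i\<in>I. (w i / W) *\<^sub>R x i) powr a \<le> (\<Sum>i\<in>I. w i / W * x i powr a)"
    by (rule convex_on_sum[OF \<open>finite I\<close> _ powr_convex_nonneg[OF \<open>a \<ge> 1\<close>]])
       (use False W w x in \<open>auto simp flip: sum_divide_distrib simp: W_def\<close>)
  also have "(\<Sum>i\<in>I. (w i / W) *\<^sub>R x i) = (\<Sum>i\<in>I. w i * x i) / W"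
    by (simp add: sum_divide_distrib)
  also have "(\<Sum>i\<in>I. w i / W * x i powr a) = (\<Sum>i\<in>I. w i * x i powr a) / W"
    by (simp add: sum_divide_distrib)
  finally have "(\<Sum>i\<in>I. w i * x i) powr a / W powr a \<le> (\<Sum>i\<in>I. w i * x i powr a) / W"
    using W by (simp add: powr_divide sum_nonneg w x)
  then show ?thesis
    using W by (simp add: powr_diff W_def[symmetric] field_simps)
qed

lemma powr_sum4_le:
  fixes a :: real
  assumes "a \<ge> 1" "p \<ge> 0" "q \<ge> 0" "r \<ge> 0" "s \<ge> 0"
  shows "(p + q + r + s) powr a \<le> 4 powr (a - 1) * (p powr a + q powr a + r powr a + s powr a)"
proof -
  have "[p, q, r, s] ! i \<ge> 0" if "i \<in> {0, 1, 2, 3}" for i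
    using that assms by auto
  then show ?thesis
    using powr_weighted_sum_le[of a "{0, 1, 2, 3::nat}" "\<lambda>_. 1" "(!) [p, q, r, s]"] assms(1)
    by (simp add: add.assoc)
qed

section \<open>Route lengths\<close>

lemma route_length_nonneg: "route_length xs \<ge> 0"
  by (induction xs rule: route_length.induct) auto

lemma route_length_append_Cons:
  "route_length (xs @ y # zs) = route_length (xs @ [y]) + route_length (y # zs)"
  by (induction xs rule: route_length.induct) auto

lemma route_length_isometry:
  assumes "\<And>x y. dist (h x) (h y) = dist x y"
  shows "route_length (map h xs) = route_length xs"
  by (induction xs rule: route_length.induct) (use assms in auto)

text \<open>A telescoping argument: \<open>P i\<close> is the position after i pieces, and
  \<open>\<Phi>\<close> pays for them. Since \<open>rest\<close> is arbitrary, the last piece can be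
  moved into it in the induction.\<close>

lemma route_length_concat_le:
  assumes "\<And>i rest. i < t \<Longrightarrow>
    route_length (P i # c (Suc i) @ rest) \<le> \<Phi> (Suc i) - \<Phi> i + route_length (P (Suc i) # rest)"
  shows "route_length (P 0 # concat (map c [1..<Suc t]) @ rest)
    \<le> \<Phi> t - \<Phi> 0 + route_length (P t # rest)"
  using assms
proof (induction t arbitrary: rest)
  case (Suc t)
  have "route_length (P 0 # concat (map c [1..<Suc t]) @ (c (Suc t) @ rest))
    \<le> \<Phi> t - \<Phi> 0 + route_length (P t # c (Suc t) @ rest)"
    using Suc.prems by (intro Suc.IH) auto
  with Suc.prems[of t rest] show ?case by simp
qed simp

lemma route_length_rightwards_le:
  assumes "p \<le> q" "mono_on {p..q} f"
  shows "route_length (f p # map f [Suc p..<Suc q] @ rest)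
    \<le> f q - f p + route_length (f q # rest)"
  using assms
proof (induction q arbitrary: rest rule: dec_induct)
  case (step q)
  have "route_length (f p # map f [Suc p..<Suc q] @ f (Suc q) # rest)
    \<le> f q - f p + route_length (f q # f (Suc q) # rest)"
    by (rule step.IH) (use step.prems in \<open>auto intro: mono_on_subset\<close>)
  moreover have "f q \<le> f (Suc q)"
    using step by (intro mono_onD[OF step.prems]) auto
  ultimately show ?case using step.hyps by (simp add: dist_real_def)
qed simp

lemma route_length_leftwards_le:
  assumes "p \<le> q" "mono_on {p..q} f"
  shows "route_length (map f (rev [p..<Suc q]) @ rest)
    \<le> f q - f p + route_length (f p # rest)"
  using assms
proof (induction q rule: dec_induct)
  case (step q)
  have eq: "map f (rev [p..<Suc q]) @ rest = f q # map f (rev [p..<q]) @ rest"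
    using step.hyps by simp
  have "route_length (map f (rev [p..<Suc q]) @ rest) \<le> f q - f p + route_length (f p # rest)"
    by (rule step.IH) (use step.prems in \<open>auto intro: mono_on_subset\<close>)
  moreover have "f q \<le> f (Suc q)"
    using step by (intro mono_onD[OF step.prems]) auto
  ultimately show ?case using step.hyps by (simp add: dist_real_def)
qed simp

section \<open>The one-dimensional algorithm\<close>

text \<open>With \<open>D i = W i + L i\<close>, the four walks are: collecting, W q - W p; to the
  last destination, |L q|; delivering, D q - D (p+1); returning, |W q - D (p+1)|. The last two are
  at most W q - W (p+1) + |L q| + |L (p+1)| and W q - W (p+1) + |L (p+1)|.\<close>

lemma route_length_GP_le:
  assumes "p < q" and W: "mono_on {p..q} W" and D: "mono_on {Suc p..q} (\<lambda>i. W i + L i)"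
  shows "route_length (W p # GP W L p q @ rest)
    \<le> 3 * (W q - W p) + 2 * \<bar>L (Suc p)\<bar> + 2 * \<bar>L q\<bar> + route_length (W q # rest)"
proof -
  define D where "D = (\<lambda>i. W i + L i)"
  define del where "del = map D (rev [Suc p..<Suc q]) @ W q # rest"
  obtain ds where del: "del = D q # ds"
    using \<open>p < q\<close> by (simp add: del_def)
  have "route_length (W p # GP W L p q @ rest)
      = route_length (W p # map W [Suc p..<Suc q] @ del)"
    using \<open>p < q\<close> by (simp add: GP_def del_def D_def upt_rec[of p])
  also have "\<dots> \<le> W q - W p + route_length (W q # del)"
    using \<open>p < q\<close> W by (intro route_length_rightwards_le) auto
  also have "route_length (W q # del) = \<bar>L q\<bar> + route_length del"
    by (simp add: del dist_real_def D_def)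
  also have "route_length del \<le> D q - D (Suc p) + route_length (D (Suc p) # W q # rest)"
    unfolding del_def using \<open>p < q\<close> D by (intro route_length_leftwards_le) (auto simp: D_def)
  finally show ?thesis
    using mono_onD[OF W, of p "Suc p"] mono_onD[OF W, of "Suc p" q] \<open>p < q\<close>
    by (simp add: dist_real_def D_def)
qed

text \<open>First and last sensors of the blocks into which \<open>GM j k N\<close> divides \<open>1, \<dots>, N\<close>.\<close>

definition block_firsts :: "nat \<Rightarrow> nat \<Rightarrow> nat \<Rightarrow> nat set" where
  "block_firsts j k N = {i \<in> {1..N}. i = 1 \<or> (i - 1) mod k = j}"

definition block_lasts :: "nat \<Rightarrow> nat \<Rightarrow> nat \<Rightarrow> nat set" where
  "block_lasts j k N = {i \<in> {1..N}. i = N \<or> i mod k = j}"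

text \<open>For f = |L| this is half of the displacement term in the length bound for a line; for f
  = 1 it counts the displacements involved.\<close>

definition block_cost :: "nat \<Rightarrow> nat \<Rightarrow> nat \<Rightarrow> (nat \<Rightarrow> real) \<Rightarrow> real" where
  "block_cost j k N f = sum f (block_firsts j k N) + sum f (block_lasts j k N)"

lemma finite_block_sets [simp]: "finite (block_firsts j k N)" "finite (block_lasts j k N)"
  by (simp_all add: block_firsts_def block_lasts_def)

text \<open>The potential \<open>\<Phi> q\<close> bounds the route up to sensor q: three times its
  position plus twice the displacements of the block ends among the first q sensors. The return from
  \<open>Z N\<close> to 0 raises the factor 3 to 4.\<close>

lemma route_length_GM_le:
  assumes k: "1 \<le> k" "k \<le> N" "j < k"
    and Z1: "0 \<le> Z 1" and Z: "mono_on {1..N} Z" and D: "mono_on {1..N} (\<lambda>i. Z i + L i)"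
  shows "route_length (0 # GM j k N Z L @ [0]) \<le> 4 * Z N + 2 * block_cost j k N (\<lambda>i. \<bar>L i\<bar>)"
proof -
  define W where "W = Z(0 := 0)"
  define F E where "F = block_firsts j k N" and "E = block_lasts j k N"
  define \<Phi> where "\<Phi> q = 3 * W q + 2 * (\<Sum>i\<in>F \<inter> {..q}. \<bar>L i\<bar>) + 2 * (\<Sum>i\<in>E \<inter> {..q}. \<bar>L i\<bar>)" for q
  define t where "t = (N - j) div k"
  define p where "p = j + k * t"
  have finF: "finite F" and finE: "finite E" by (simp_all add: F_def E_def)
  have pN: "p \<le> N"
    using k times_div_less_eq_dividend[of k "N - j"] unfolding p_def t_def by linarith
  have W: "mono_on {0..N} W"
  proof (rule mono_onI)
    fix r s assume rs: "r \<in> {0..N}" "s \<in> {0..N}" "r \<le> s"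
    then have "0 \<le> Z s" if "s \<noteq> 0"
      using mono_onD[OF Z, of 1 s] Z1 that by auto
    with rs show "W r \<le> W s"
      using mono_onD[OF Z, of r s] by (auto simp: W_def)
  qed
  \<comment> \<open>The block only has to start in \<open>F\<close> and end in \<open>E\<close>: its
    two displacements are then new summands of \<open>\<Phi> v\<close>, and any others only enlarge
    it.\<close>
  have step: "route_length (W u # GP W L u v @ rest) \<le> \<Phi> v - \<Phi> u + route_length (W v # rest)"
    if uv: "u < v" "v \<le> N" "Suc u \<in> F" "v \<in> E" for u v rest
  proof -
    have gain: "(\<Sum>i\<in>S \<inter> {..u}. \<bar>L i\<bar>) + \<bar>L x\<bar> \<le> (\<Sum>i\<in>S \<inter> {..v}. \<bar>L i\<bar>)"
      if "finite S" "x \<in> S" "u < x" "x \<le> v" for S x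
    proof -
      have "(\<Sum>i\<in>insert x (S \<inter> {..u}). \<bar>L i\<bar>) \<le> (\<Sum>i\<in>S \<inter> {..v}. \<bar>L i\<bar>)"
        using that uv by (intro sum_mono2) auto
      then show ?thesis using that by simp
    qed
    have "route_length (W u # GP W L u v @ rest)
      \<le> 3 * (W v - W u) + 2 * \<bar>L (Suc u)\<bar> + 2 * \<bar>L v\<bar> + route_length (W v # rest)"
    proof (rule route_length_GP_le)
      show "mono_on {u..v} W" using uv by (intro mono_on_subset[OF W]) auto
      show "mono_on {Suc u..v} (\<lambda>i. W i + L i)"
        using uv by (intro mono_onI) (auto simp: W_def intro!: mono_onD[OF D, simplified])
    qed fact
    moreover have "(\<Sum>i\<in>F \<inter> {..u}. \<bar>L i\<bar>) + \<bar>L (Suc u)\<bar> \<le> (\<Sum>i\<in>F \<inter> {..v}. \<bar>L i\<bar>)"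
      using uv finF by (intro gain) auto
    moreover have "(\<Sum>i\<in>E \<inter> {..u}. \<bar>L i\<bar>) + \<bar>L v\<bar> \<le> (\<Sum>i\<in>E \<inter> {..v}. \<bar>L i\<bar>)"
      using uv finE by (intro gain) auto
    ultimately show ?thesis by (simp add: \<Phi>_def)
  qed
  have \<Phi>0: "\<Phi> 0 = 0"
    by (auto simp: \<Phi>_def W_def F_def E_def block_firsts_def block_lasts_def intro!: sum.neutral)
  have \<Phi>N: "\<Phi> N = 3 * W N + 2 * block_cost j k N (\<lambda>i. \<bar>L i\<bar>)"
  proof -
    have "F \<inter> {..N} = F" "E \<inter> {..N} = E"
      by (auto simp: F_def E_def block_firsts_def block_lasts_def)
    then show ?thesis by (simp add: \<Phi>_def block_cost_def F_def E_def)
  qed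
  define mid where "mid = (\<lambda>i. GP W L (j + k * (i - 1)) (j + k * (i - 1) + k))"
  define fin where "fin = (if p < N then GP W L p N else [])"
  have "0 # GM j k N Z L @ [0] =
    W 0 # (if j > 0 then GP W L 0 j else []) @ concat (map mid [1..<Suc t]) @ fin @ [0]"
    by (simp add: GM_def Let_def mid_def fin_def p_def t_def W_def)
  \<comment> \<open>The three stages (short first block, full blocks, remainder) take the robot from
    index 0 to \<open>j\<close>, \<open>p\<close> and \<open>N\<close>, each at the price of the
    increase of \<open>\<Phi>\<close>. An empty stage leaves the index unchanged.\<close>
  also have "route_length \<dots> \<le> \<Phi> j + route_length (W j # concat (map mid [1..<Suc t]) @ fin @ [0])"
  proof (cases "j > 0")
    case True
    have "Suc 0 \<in> F" "j \<in> E"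
      using k True by (auto simp: F_def E_def block_firsts_def block_lasts_def)
    then show ?thesis using step[of 0 j] True k \<Phi>0 by simp
  qed (simp add: \<Phi>0)
  also have "route_length (W j # concat (map mid [1..<Suc t]) @ fin @ [0])
    \<le> \<Phi> p - \<Phi> j + route_length (W p # fin @ [0])"
  proof -
    have "route_length (W (j + k * i) # mid (Suc i) @ rest)
      \<le> \<Phi> (j + k * Suc i) - \<Phi> (j + k * i) + route_length (W (j + k * Suc i) # rest)"
      if "i < t" for i rest
    proof -
      have "k * Suc i \<le> k * t" using that by (intro mult_le_mono2) simp
      then have le: "j + k * i + k \<le> N" using pN unfolding p_def by simp
      have "Suc (j + k * i) \<in> F" "j + k * i + k \<in> E"
        using k le by (auto simp: F_def E_def block_firsts_def block_lasts_def)
      then show ?thesis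
        using step[of "j + k * i" "j + k * i + k" rest] k le
        by (simp add: mid_def add_ac)
    qed
    from route_length_concat_le[of t "\<lambda>i. W (j + k * i)" mid "\<lambda>i. \<Phi> (j + k * i)", OF this]
    show ?thesis by (simp add: p_def)
  qed
  also have "route_length (W p # fin @ [0]) \<le> \<Phi> N - \<Phi> p + route_length (W N # [0])"
  proof (cases "p < N")
    case True
    have "Suc p \<in> F" "N \<in> E"
      using k True by (auto simp: F_def E_def block_firsts_def block_lasts_def p_def)
    then show ?thesis using step[of p N "[0]"] True by (simp add: fin_def)
  qed (use pN in \<open>simp add: fin_def\<close>)
  finally show ?thesis
    using \<Phi>N mono_onD[OF W, of 0 N] k by (simp add: W_def dist_real_def)
qed

section \<open>Averaging over the shifts\<close>

text \<open>Within a residue class the quotient by \<open>k\<close> determines the element, and it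
  is at most \<open>N div k\<close>.\<close>

lemma card_residue_class_le:
  fixes k :: nat
  shows "card {x \<in> {..N}. x mod k = j} \<le> N div k + 1"
proof -
  have "inj_on (\<lambda>x. x div k) {x \<in> {..N}. x mod k = j}"
  proof (rule inj_onI)
    fix x y assume "x \<in> {x \<in> {..N}. x mod k = j}" "y \<in> {x \<in> {..N}. x mod k = j}" "x div k = y div k"
    then show "x = y"
      using div_mult_mod_eq[of x k] div_mult_mod_eq[of y k] by simp
  qed
  moreover have "(\<lambda>x. x div k) ` {x \<in> {..N}. x mod k = j} \<subseteq> {..N div k}"
    by (auto intro: div_le_mono)
  ultimately show ?thesis
    using card_inj_on_le[of "\<lambda>x. x div k" _ "{..N div k}"] by simp
qed

text \<open>Apart from sensor 1, which opens a block for every shift, the predecessors of the block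
  firsts lie in a single residue class.\<close>

lemma card_block_firsts_le: "card (block_firsts j k N) \<le> N div k + 2"
proof -
  have "block_firsts j k N \<subseteq> insert 1 (Suc ` {x \<in> {..N}. x mod k = j})"
  proof
    fix i assume "i \<in> block_firsts j k N"
    then show "i \<in> insert 1 (Suc ` {x \<in> {..N}. x mod k = j})"
      by (cases i) (auto simp: block_firsts_def)
  qed
  then have "card (block_firsts j k N) \<le> card (insert 1 (Suc ` {x \<in> {..N}. x mod k = j}))"
    by (intro card_mono) auto
  also have "\<dots> \<le> Suc (card {x \<in> {..N}. x mod k = j})"
    by (rule order_trans[OF card_insert_le_m1]) (auto intro: card_image_le)
  finally show ?thesis using card_residue_class_le[of N k j] by simp
qed

lemma card_block_lasts_le: "card (block_lasts j k N) \<le> N div k + 2"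
proof -
  have "card (block_lasts j k N) \<le> card (insert N {x \<in> {..N}. x mod k = j})"
    by (intro card_mono) (auto simp: block_lasts_def)
  also have "\<dots> \<le> Suc (card {x \<in> {..N}. x mod k = j})"
    by (rule card_insert_le_m1) auto
  finally show ?thesis using card_residue_class_le[of N k j] by simp
qed

text \<open>A sensor i other than 1 opens a block for exactly one shift, j = (i - 1) mod k.\<close>

lemma sum_block_firsts_mem:
  assumes "i \<in> {1..N}" "1 \<le> k"
  shows "(\<Sum>j<k. of_bool (i \<in> block_firsts j k N)) = (if i = 1 then real k else 1)"
proof (cases "i = 1")
  case False
  then have "(\<Sum>j<k. of_bool (i \<in> block_firsts j k N)) = (\<Sum>j<k. if (i - 1) mod k = j then 1 else 0 :: real)"
    using assms by (intro sum.cong) (auto simp: block_firsts_def)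
  with False assms show ?thesis by simp
qed (use assms in \<open>simp add: block_firsts_def\<close>)

lemma sum_block_lasts_mem:
  assumes "i \<in> {1..N}" "1 \<le> k"
  shows "(\<Sum>j<k. of_bool (i \<in> block_lasts j k N)) = (if i = N then real k else 1)"
proof (cases "i = N")
  case False
  then have "(\<Sum>j<k. of_bool (i \<in> block_lasts j k N)) = (\<Sum>j<k. if i mod k = j then 1 else 0 :: real)"
    using assms by (intro sum.cong) (auto simp: block_lasts_def)
  with False assms show ?thesis by simp
qed (use assms in \<open>simp add: block_lasts_def\<close>)

text \<open>With the dependence on \<open>j\<close> moved into the weights, the power mean
  inequality applies and the sums over \<open>i\<close> and \<open>j\<close> can be
  exchanged.\<close>

lemma block_cost_eq_weighted_sum:
  "block_cost j k N f =
    (\<Sum>i=1..N. (of_bool (i \<in> block_firsts j k N) + of_bool (i \<in> block_lasts j k N)) * f i)"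
proof -
  have "block_firsts j k N \<subseteq> {1..N}" "block_lasts j k N \<subseteq> {1..N}"
    by (auto simp: block_firsts_def block_lasts_def)
  then show ?thesis
    by (simp add: block_cost_def distrib_right sum.distrib Int_absorb1)
qed

lemma exists_le_average:
  fixes g :: "nat \<Rightarrow> real"
  assumes "1 \<le> k" "(\<Sum>j<k. g j) \<le> real k * c"
  shows "\<exists>j<k. g j \<le> c"
proof (rule ccontr)
  assume "\<not> ?thesis"
  then have "(\<Sum>j<k. c) < (\<Sum>j<k. g j)"
    using assms(1) by (intro sum_strict_mono) (auto simp: not_le lessThan_empty_iff)
  with assms(2) show False by simp
qed

text \<open>
  In the average over the shifts every displacement is counted \<open>2 / k\<close> times, except that the first
  and the last one are counted \<open>1 + 1 / k\<close> times (twice if they coincide), where the bound allows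
  \<open>1 + 2 / k\<close>. Since \<open>k \<le> m\<close>, the surplus \<open>2 * m / k \<ge> 2\<close> pays for the summands
  \<open>2 * \<bar>L 1\<bar> + \<bar>L m\<bar>\<close>, which come from the walk along the first axis.
\<close>

lemma exists_shift_block_cost_powr_le:
  fixes a :: real and L :: "nat \<Rightarrow> real"
  assumes a: "a \<ge> 1" and k: "1 \<le> k" "k \<le> m"
  shows "\<exists>j<k. (real m * (2 * block_cost j k m (\<lambda>i. \<bar>L i\<bar>)) + 2 * \<bar>L 1\<bar> + \<bar>L m\<bar>) powr a
    \<le> (real m * (4 * real (m div k) + 16)) powr (a - 1) * (real m *
        (4 / real k * (\<Sum>i=1..m. \<bar>L i\<bar> powr a) + 2 * \<bar>L 1\<bar> powr a + 2 * \<bar>L m\<bar> powr a))"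
    (is "\<exists>j<k. ?cost j powr a \<le> ?C powr (a - 1) * (real m * ?B)")
proof (rule exists_le_average[OF k(1)])
  \<comment> \<open>The coefficient of |L i| in \<open>?cost j\<close>; the power mean inequality
    keeps these weights for the powers \<open>f i\<close>.\<close>
  define w :: "nat \<Rightarrow> nat \<Rightarrow> real" where
    "w j i = real m * (2 * (of_bool (i \<in> block_firsts j k m) + of_bool (i \<in> block_lasts j k m)))
      + 2 * of_bool (i = 1) + of_bool (i = m)" for j i
  define f where "f i = \<bar>L i\<bar> powr a" for i
  have w_nonneg: "w j i \<ge> 0" for j i by (simp add: w_def)
  have m1: "1 \<le> m" using k by simp
  have sum_w: "(\<Sum>i=1..m. w j i * g i) = real m * (2 * block_cost j k m g) + 2 * g 1 + g m" for j g
  proof -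
    have "(\<Sum>i=1..m. w j i * g i) = real m * (2 * block_cost j k m g)
      + 2 * (\<Sum>i=1..m. of_bool (i = 1) * g i) + (\<Sum>i=1..m. of_bool (i = m) * g i)"
      unfolding block_cost_eq_weighted_sum sum_distrib_left sum.distrib[symmetric]
      by (intro sum.cong) (simp_all add: w_def algebra_simps)
    then show ?thesis using m1 by simp
  qed
  \<comment> \<open>Blocks contribute at most m (4 (m div k) + 8), and the two axis terms contribute
    3 \<le> 8 m.\<close>
  have total: "(\<Sum>i=1..m. w j i) \<le> ?C" for j
  proof -
    have "block_cost j k m (\<lambda>_. 1) \<le> 2 * real (m div k) + 4"
      using card_block_firsts_le[of j k m] card_block_lasts_le[of j k m]
      by (simp add: block_cost_def)
    then have "real m * (2 * block_cost j k m (\<lambda>_. 1)) \<le> real m * (4 * real (m div k) + 8)"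
      by (intro mult_left_mono) auto
    then show ?thesis
      using sum_w[of j "\<lambda>_. 1"] m1 by (simp add: distrib_left)
  qed
  have shift_cost: "?cost j powr a \<le> ?C powr (a - 1) * (\<Sum>i=1..m. w j i * f i)" for j
  proof -
    have "?cost j powr a = (\<Sum>i=1..m. w j i * \<bar>L i\<bar>) powr a"
      by (simp only: sum_w)
    also have "\<dots> \<le> (\<Sum>i=1..m. w j i) powr (a - 1) * (\<Sum>i=1..m. w j i * f i)"
      unfolding f_def by (intro powr_weighted_sum_le a) (auto simp: w_nonneg)
    also have "\<dots> \<le> ?C powr (a - 1) * (\<Sum>i=1..m. w j i * f i)"
      using total[of j] a
      by (intro mult_right_mono powr_mono2 sum_nonneg) (auto simp: w_nonneg f_def)
    finally show ?thesis .
  qed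
  have "(\<Sum>j<k. \<Sum>i=1..m. w j i * f i) = (\<Sum>i=1..m. (\<Sum>j<k. w j i) * f i)"
    by (subst sum.swap) (simp add: sum_distrib_right)
  also have "\<dots> \<le> (\<Sum>i=1..m. (4 * real m + 2 * real m * real k * of_bool (i = 1)
      + 2 * real m * real k * of_bool (i = m)) * f i)"
  proof (intro sum_mono mult_right_mono)
    fix i assume i: "i \<in> {1..m}"
    have "(\<Sum>j<k. w j i) = real m * (2 * ((if i = 1 then real k else 1) + (if i = m then real k else 1)))
      + 2 * real k * of_bool (i = 1) + real k * of_bool (i = m)"
      unfolding w_def sum.distrib sum_distrib_left[symmetric]
        sum_block_firsts_mem[OF i k(1)] sum_block_lasts_mem[OF i k(1)] by simp
    \<comment> \<open>For m > 1 the left side is 2mk + 2m + 2k at sensor 1, 2mk + 2m + k at sensor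
      m, and 4m elsewhere, so \<open>k \<le> m\<close> suffices. For m = 1 it is 7, against
      8.\<close>
    then show "(\<Sum>j<k. w j i) \<le> 4 * real m + 2 * real m * real k * of_bool (i = 1)
      + 2 * real m * real k * of_bool (i = m)"
      using k by (auto simp: algebra_simps)
  qed (simp add: f_def)
  also have "\<dots> = real k * (real m * ?B)"
  proof -
    have "(\<Sum>i=1..m. of_bool (i = c) * f i) = f c" if "c \<in> {1..m}" for c
      using that by (simp add: sum_of_bool_mult_eq)
    from this[of 1] this[of m] have "(\<Sum>i=1..m. (4 * real m + 2 * real m * real k * of_bool (i = 1)
      + 2 * real m * real k * of_bool (i = m)) * f i)
      = 4 * real m * (\<Sum>i=1..m. f i) + 2 * real m * real k * f 1 + 2 * real m * real k * f m"
      using m1 by (simp add: distrib_right sum.distrib mult.assoc flip: sum_distrib_left)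
    then show ?thesis using k(1) by (simp add: f_def field_simps)
  qed
  finally have avg: "(\<Sum>j<k. \<Sum>i=1..m. w j i * f i) \<le> real k * (real m * ?B)" .
  have "(\<Sum>j<k. ?cost j powr a) \<le> ?C powr (a - 1) * (\<Sum>j<k. \<Sum>i=1..m. w j i * f i)"
    using sum_mono[OF shift_cost] by (simp add: sum_distrib_left)
  also have "\<dots> \<le> ?C powr (a - 1) * (real k * (real m * ?B))"
    by (intro mult_left_mono avg) simp
  finally show "(\<Sum>j<k. ?cost j powr a) \<le> real k * (?C powr (a - 1) * (real m * ?B))"
    by (simp add: mult_ac)
qed

section \<open>The planar algorithm\<close>

text \<open>The isometry \<open>h\<close> places the line in the plane; the two visits to
  \<open>h 0\<close> are the images of the zeros enclosing \<open>g\<close>.\<close>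

lemma route_length_excursion:
  fixes h :: "real \<Rightarrow> 'a::metric_space"
  assumes "\<And>x y. dist (h x) (h y) = dist x y"
  shows "route_length (x # ([h 0] @ map h g @ [h 0]) @ rest)
    = dist x (h 0) + route_length (0 # g @ [0]) + route_length (h 0 # rest)"
  using route_length_append_Cons[of "h 0 # map h g" "h 0" rest]
    route_length_isometry[of h "0 # g @ [0]"] assms by simp

text \<open>Each of the m rows and m columns costs its line bound. Between them the robot goes up to
  height \<open>Y m\<close>, back to the origin and along the first axis; the resulting 2 Y m + X m
  is absorbed by m \<ge> 1, giving 6 = 4 + 2 and 5 = 4 + 1.\<close>

lemma route_length_GM_planar_le:
  assumes k: "1 \<le> k" "k \<le> m" and j: "j1 < k" "j2 < k"
    and X: "0 \<le> X 1" "mono_on {1..m} X" and Y: "0 \<le> Y 1" "mono_on {1..m} Y"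
    and XM: "mono_on {1..m} (\<lambda>i. X i + M i)" and YN: "mono_on {1..m} (\<lambda>i. Y i + N i)"
  shows "route_length (GM_planar j1 j2 k m X Y M N) \<le> 5 * real m * X m + 6 * real m * Y m
    + (real m * (2 * block_cost j2 k m (\<lambda>i. \<bar>M i\<bar>)) + 2 * \<bar>M 1\<bar> + \<bar>M m\<bar>)
    + real m * (2 * block_cost j1 k m (\<lambda>i. \<bar>N i\<bar>))"
proof -
  define H where "H = 4 * X m + 2 * block_cost j2 k m (\<lambda>i. \<bar>M i\<bar>)"
  define V where "V = 4 * Y m + 2 * block_cost j1 k m (\<lambda>i. \<bar>N i\<bar>)"
  have H: "route_length (0 # GM j2 k m X M @ [0]) \<le> H"
    unfolding H_def using k j X XM by (intro route_length_GM_le)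
  have V: "route_length (0 # GM j1 k m Y N @ [0]) \<le> V"
    unfolding V_def using k j Y YN by (intro route_length_GM_le)
  have m1: "1 \<le> m" using k by simp
  define row where "row = (\<lambda>i. [(0, Y i)] @ map (\<lambda>x. (x, Y i)) (GM j2 k m X M) @ [(0, Y i)])"
  define col where "col = (\<lambda>i. [(X i + M i, 0)] @ map (\<lambda>y. (X i + M i, y)) (GM j1 k m Y N) @
    [(X i + M i, 0)])"
  define P where "P i = (0::real, (Y(0 := 0)) i)" for i
  define Q where "Q i = (if i = 0 then (0, 0::real) else (X i + M i, 0))" for i
  define \<Phi> where "\<Phi> i = (Y(0 := 0)) i + real i * H" for i
  \<comment> \<open>The first destination X 1 + M 1 may be negative, so only the initial walk needs
    an absolute value; all later ones go rightwards.\<close>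
  define \<Psi> where "\<Psi> i = (if i = 0 then 0 else \<bar>X 1 + M 1\<bar> + (X i + M i - (X 1 + M 1)) + real i * V)" for i
  have "route_length (P i # row (Suc i) @ rest) \<le> \<Phi> (Suc i) - \<Phi> i + route_length (P (Suc i) # rest)"
    if "i < m" for i rest
  proof -
    have "dist (P i) (0, Y (Suc i)) = Y (Suc i) - (Y(0 := 0)) i"
      using that Y(1) mono_onD[OF Y(2), of i "Suc i"]
      by (auto simp: P_def dist_Pair_Pair dist_real_def)
    moreover have "route_length (P i # row (Suc i) @ rest)
      = dist (P i) (0, Y (Suc i)) + route_length (0 # GM j2 k m X M @ [0])
        + route_length ((0, Y (Suc i)) # rest)"
      unfolding row_def by (rule route_length_excursion) (simp add: dist_Pair_Pair)
    ultimately show ?thesis using H by (simp add: \<Phi>_def P_def algebra_simps)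
  qed
  from route_length_concat_le[of m P row \<Phi>, OF this]
  have rows: "route_length ((0, 0) # concat (map row [1..<Suc m]) @ rest)
    \<le> Y m + real m * H + route_length ((0, Y m) # rest)" for rest
    using m1 by (simp add: P_def \<Phi>_def)
  have "route_length (Q i # col (Suc i) @ rest) \<le> \<Psi> (Suc i) - \<Psi> i + route_length (Q (Suc i) # rest)"
    if "i < m" for i rest
  proof -
    have "dist (Q i) (X (Suc i) + M (Suc i), 0) = \<Psi> (Suc i) - \<Psi> i - V"
      using that mono_onD[OF XM, of i "Suc i"]
      by (auto simp: Q_def \<Psi>_def dist_Pair_Pair dist_real_def algebra_simps)
    moreover have "route_length (Q i # col (Suc i) @ rest)
      = dist (Q i) (X (Suc i) + M (Suc i), 0) + route_length (0 # GM j1 k m Y N @ [0])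
        + route_length ((X (Suc i) + M (Suc i), 0) # rest)"
      unfolding col_def by (rule route_length_excursion) (simp add: dist_Pair_Pair)
    ultimately show ?thesis using V by (simp add: Q_def)
  qed
  from route_length_concat_le[of m Q col \<Psi> "[]", OF this]
  have cols: "route_length ((0, 0) # concat (map col [1..<Suc m]))
    \<le> \<bar>X 1 + M 1\<bar> + (X m + M m - (X 1 + M 1)) + real m * V"
    using m1 by (simp add: Q_def \<Psi>_def)
  have Xm: "0 \<le> X m" and Ym: "0 \<le> Y m"
    using mono_onD[OF X(2), of 1 m] mono_onD[OF Y(2), of 1 m] X(1) Y(1) m1 by auto
  have "GM_planar j1 j2 k m X Y M N = (0, 0) # concat (map row [1..<Suc m]) @
      (0, 0) # concat (map col [1..<Suc m])"
    by (simp only: GM_planar_def row_def col_def append.simps)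
  also have "route_length \<dots> \<le> Y m + real m * H
      + route_length ((0, Y m) # (0, 0) # concat (map col [1..<Suc m]))"
    by (rule rows)
  also have "\<dots> = Y m + real m * H + (Y m + route_length ((0, 0) # concat (map col [1..<Suc m])))"
    using Ym by (simp add: dist_Pair_Pair dist_real_def del: upt_Suc)
  \<comment> \<open>Since X 1 \<ge> 0, the difference |X 1 + M 1| - (X 1 + M 1) is at most 2 |M
    1|.\<close>
  also have "\<dots> \<le> Y m + real m * H + (Y m + (X m + 2 * \<bar>M 1\<bar> + \<bar>M m\<bar> + real m * V))"
    using cols X(1) by linarith
  also have "\<dots> \<le> 5 * real m * X m + 6 * real m * Y m
    + (real m * (2 * block_cost j2 k m (\<lambda>i. \<bar>M i\<bar>)) + 2 * \<bar>M 1\<bar> + \<bar>M m\<bar>)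
    + real m * (2 * block_cost j1 k m (\<lambda>i. \<bar>N i\<bar>))"
    using mult_right_mono[of 1 "real m" "X m"] mult_right_mono[of 1 "real m" "Y m"] Xm Ym m1
    by (simp add: H_def V_def algebra_simps)
  finally show ?thesis .
qed

theorem theorem3:
  fixes a :: real and n m k :: nat and X Y M N :: "nat \<Rightarrow> real"
  assumes "a \<ge> 1"
    and "m > 0" and "n = m ^ 2"
    and "1 \<le> k" and "real k \<le> sqrt (real n)"
    and "0 \<le> X 1" and "mono_on {1..m} X"
    and "0 \<le> Y 1" and "mono_on {1..m} Y"
    and "mono_on {1..m} (\<lambda>i. X i + M i)"
    and "mono_on {1..m} (\<lambda>i. Y i + N i)"
  shows "(MIN (j1, j2) \<in> {0..k - 1} \<times> {0..k - 1}. T_RS a j1 j2 k m X Y M N)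
    \<le> 4 powr a * real n powr (a / 2 - 1 / 2)
          * (4 * real_of_int \<lfloor>sqrt (real n) / real k\<rfloor> + 16) powr (a - 1)
          * (T_AS a m M N / real k)
      + 4 powr (a - 1) * real n powr (a / 2)
          * (4 * real_of_int \<lfloor>sqrt (real n) / real k\<rfloor> + 16) powr (a - 1)
          * (2 * \<bar>M 1\<bar> powr a + 2 * \<bar>M m\<bar> powr a)
      + 4 powr (a - 1) * real n powr (a / 2)
          * (4 * real_of_int \<lfloor>sqrt (real n) / real k\<rfloor> + 16) powr (a - 1)
          * (2 * \<bar>N 1\<bar> powr a + 2 * \<bar>N m\<bar> powr a)
      + (2 powr (3 * a - 1) + 6 powr a * 4 powr (a - 1) * real n powr (a / 2)) * Y m powr a
      + (4 powr (a - 1) + 6 powr a * 4 powr (a - 1) * real n powr (a / 2)) * X m powr a"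
proof -
  have sqrt_n: "sqrt (real n) = real m" using assms(3) by simp
  have k: "1 \<le> k" "k \<le> m" using assms(4,5) sqrt_n by auto
  have m: "real m > 0" using assms(2) by simp
  define G where "G = (4 * real (m div k) + 16) powr (a - 1)"
  define SM where "SM = (\<Sum>i=1..m. \<bar>M i\<bar> powr a)"
  define SN where "SN = (\<Sum>i=1..m. \<bar>N i\<bar> powr a)"
  define BM where "BM = 4 / real k * SM + 2 * \<bar>M 1\<bar> powr a + 2 * \<bar>M m\<bar> powr a"
  define BN where "BN = 4 / real k * SN + 2 * \<bar>N 1\<bar> powr a + 2 * \<bar>N m\<bar> powr a"
  have floor: "4 * real_of_int \<lfloor>sqrt (real n) / real k\<rfloor> + 16 = 4 * real (m div k) + 16"
    by (simp add: sqrt_n floor_divide_of_nat_eq)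
  have n_powr: "real n powr b = real m powr (2 * b)" for b
    using m by (simp add: assms(3) powr_powr flip: powr_numeral)
  have AS: "T_AS a m M N = real m * (SM + SN)"
    by (simp add: T_AS_def SM_def SN_def sum.distrib sum_distrib_left distrib_left)
  have pull: "(real m * (4 * real (m div k) + 16)) powr (a - 1) * (real m * B) = real m powr a * G * B" for B
    using m by (simp add: G_def powr_mult powr_diff)
  \<comment> \<open>The rows depend only on \<open>j2\<close> and \<open>M\<close>, the columns only
    on \<open>j1\<close> and \<open>N\<close>, so the two shifts can be chosen by separate
    averages.\<close>
  obtain j2 where j2: "j2 < k" and
    "(real m * (2 * block_cost j2 k m (\<lambda>i. \<bar>M i\<bar>)) + 2 * \<bar>M 1\<bar> + \<bar>M m\<bar>) powr a \<le> real m powr a * G * BM"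
    using exists_shift_block_cost_powr_le[OF assms(1) k, of M] unfolding pull BM_def SM_def by blast
  moreover define U where "U = real m * (2 * block_cost j2 k m (\<lambda>i. \<bar>M i\<bar>)) + 2 * \<bar>M 1\<bar> + \<bar>M m\<bar>"
  ultimately have U: "U powr a \<le> real m powr a * G * BM" by simp
  obtain j1 where j1: "j1 < k" and
    j1_le: "(real m * (2 * block_cost j1 k m (\<lambda>i. \<bar>N i\<bar>)) + 2 * \<bar>N 1\<bar> + \<bar>N m\<bar>) powr a \<le> real m powr a * G * BN"
    using exists_shift_block_cost_powr_le[OF assms(1) k, of N] unfolding pull BN_def SN_def by blast
  define V where "V = real m * (2 * block_cost j1 k m (\<lambda>i. \<bar>N i\<bar>))"
  have cost_nonneg: "block_cost j k m (\<lambda>i. \<bar>f i\<bar>) \<ge> 0" for j and f :: "nat \<Rightarrow> real"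
    by (simp add: block_cost_def sum_nonneg)
  have UV: "U \<ge> 0" "V \<ge> 0"
    using cost_nonneg by (simp_all add: U_def V_def)
  \<comment> \<open>The walk up the second axis visits the original heights \<open>Y i\<close>, so
    no displacements arise from it and the terms 2 |N 1| + |N m| are dropped.\<close>
  have V: "V powr a \<le> real m powr a * G * BN"
    using UV assms(1) by (intro order_trans[OF _ j1_le] powr_mono2) (auto simp: V_def)
  have Xm: "0 \<le> X m" and Ym: "0 \<le> Y m"
    using mono_onD[OF assms(7), of 1 m] mono_onD[OF assms(9), of 1 m] assms(2,6,8) by auto
  have "(MIN (j1, j2) \<in> {0..k - 1} \<times> {0..k - 1}. T_RS a j1 j2 k m X Y M N) \<le> T_RS a j1 j2 k m X Y M N"
    using j1 j2 by (intro Min_le) (auto intro!: image_eqI[of _ _ "(j1, j2)"])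
  also have "\<dots> \<le> (5 * real m * X m + 6 * real m * Y m + U + V) powr a"
    unfolding T_RS_def U_def V_def using assms(1) route_length_nonneg
    by (intro powr_mono2 route_length_GM_planar_le k j1 j2 assms) auto
  also have "\<dots> \<le> 4 powr (a - 1) * ((5 * real m * X m) powr a + (6 * real m * Y m) powr a + U powr a + V powr a)"
    using assms(1) Xm Ym UV by (intro powr_sum4_le) auto
  also have "\<dots> \<le> 4 powr (a - 1) * ((6 * real m * X m) powr a + (6 * real m * Y m) powr a
      + real m powr a * G * BM + real m powr a * G * BN)"
    using assms(1) Xm Ym m by (intro mult_left_mono add_mono U V powr_mono2 mult_right_mono) auto
  also have "\<dots> = 4 powr (a - 1) * real m powr a * G * (BM + BN)
      + 6 powr a * 4 powr (a - 1) * real m powr a * Y m powr a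
      + 6 powr a * 4 powr (a - 1) * real m powr a * X m powr a"
    using Xm Ym m by (simp add: powr_mult algebra_simps)
  \<comment> \<open>The coefficient 4 / k of the sums turns 4^(a-1) into 4^a, and one factor m joins
    SM + SN to form \<open>T_AS\<close>.\<close>
  also have "4 powr (a - 1) * real m powr a * G * (BM + BN)
      = 4 powr a * real m powr (a - 1) * G * (real m * (SM + SN) / real k)
        + 4 powr (a - 1) * real m powr a * G * (2 * \<bar>M 1\<bar> powr a + 2 * \<bar>M m\<bar> powr a)
        + 4 powr (a - 1) * real m powr a * G * (2 * \<bar>N 1\<bar> powr a + 2 * \<bar>N m\<bar> powr a)"
    using m k by (simp add: BM_def BN_def powr_diff field_simps)
  \<comment> \<open>The factor 6^a already covers the axis walks; the terms with 2^(3a-1) and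
    4^(a-1) are nonnegative additions.\<close>
  also have "\<dots> + 6 powr a * 4 powr (a - 1) * real m powr a * Y m powr a
      + 6 powr a * 4 powr (a - 1) * real m powr a * X m powr a
    \<le> \<dots> + (2 powr (3 * a - 1) + 6 powr a * 4 powr (a - 1) * real m powr a) * Y m powr a
      + (4 powr (a - 1) + 6 powr a * 4 powr (a - 1) * real m powr a) * X m powr a"
    by (intro add_mono mult_right_mono order_refl) auto
  finally show ?thesis
    unfolding floor AS n_powr G_def by (simp add: right_diff_distrib)
qed

end
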